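(* Let $(\mathrm{L},H,G)$ be the $4$-dimensional almost hypercomplex pseudo-Hermitian manifold on the Lie group $\mathrm{L}$ described in the context (with real parameters $(\lambda_1,\lambda_2,\lambda_3,\lambda_4)\neq(0,0,0,0)$). Then, with respect to the three almost complex structures $J_1,J_2,J_3$ of $H$, $$(\mathrm{L},H,G)\in\mathcal{W}_4(J_1)\cap\mathcal{W}_3(J_2)\cap\mathcal{W}_3(J_3).$$
   Context: The Lie group. $\mathrm{L}$ is a connected Lie group whose Lie algebra has a global basis of left-invariant vector fields $\{X_1,X_2,X_3,X_4\}$ with $$[X_1,X_3]=\lambda_2X_2+\lambda_4X_4,\quad [X_2,X_4]=\lambda_1X_1+\lambda_3X_3,\quad [X_2,X_3]=-\lambda_2X_1-\lambda_3X_4,$$ $$[X_3,X_4]=-\lambda_4X_1+\lambda_3X_2,\quad [X_4,X_1]=\lambda_1X_2+\lambda_4X_3,\quad [X_2,X_1]=-\lambda_2X_3+\lambda_1X_4,$$ where $\lambda_i\in\mathbb{R}$ and $(\lambda_1,\lambda_2,\lambda_3,\lambda_4)\neq(0,0,0,0)$. The metric. $g$ is the left-invariant pseudo-Riemannian metric with $g(X_1,X_1)=g(X_2,X_2)=-g(X_3,X_3)=-g(X_4,X_4)=1$ and $g(X_i,X_j)=0$ for $i\ne j$; it satisfies $g([X_i,X_j],X_k)+g([X_i,X_k],X_j)=0$. The structure $H=(J_1,J_2,J_3)$ (left-invariant almost complex structures). $J_1X_1=X_2,\ J_1X_2=-X_1,\ J_1X_3=-X_4,\ J_1X_4=X_3$;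 $J_2X_1=X_3,\ J_2X_2=X_4,\ J_2X_3=-X_1,\ J_2X_4=-X_2$; $J_3=J_1J_2$. One has $g(J_1x,J_1y)=-g(J_2x,J_2y)=-g(J_3x,J_3y)=g(x,y)$. $G=(g,\Phi,g_2,g_3)$ with $\Phi(x,y)=g(J_1x,y)$, $g_2(x,y)=g(J_2x,y)$, $g_3(x,y)=g(J_3x,y)$. The classes. Let $\nabla$ be the Levi-Civita connection of $g$, $F_\alpha(x,y,z)=g((\nabla_xJ_\alpha)y,z)$, and $\theta_\alpha(z)=g^{ij}F_\alpha(e_i,e_j,z)$ for an arbitrary basis $\{e_i\}$ of the tangent space (with $(g^{ij})$ the inverse of the matrix $(g(e_i,e_j))$; summation over repeated indices), $\alpha=1,2,3$. For manifolds of dimension $4n$ the class $\mathcal{W}_4(J_1)$ is defined by $$F_1(x,y,z)=\tfrac{1}{2(2n-1)}\{g(x,y)\theta_1(z)-g(x,z)\theta_1(y)-g(x,J_1y)\theta_1(J_1z)+g(x,J_1z)\theta_1(J_1y)\},$$ (here $n=1$, so the coefficient is $\tfrac12$), and for $\alpha=2,3$ the class $\mathcal{W}_3(J_\alpha)$ is defined by $F_\alpha(x,y,z)+F_\alpha(y,z,x)+F_\alpha(z,x,y)=0$, for all tangent vectors $x,y,z$. *)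

theory Defs
  imports "HOL-Analysis.Analysis" "HOL-Library.Function_Algebras"
begin

instantiation "fun" :: (type, scaleR) scaleR
begin
definition scaleR_fun :: "real \<Rightarrow> ('a \<Rightarrow> 'b) \<Rightarrow> 'a \<Rightarrow> 'b"
  where "scaleR_fun r f = (\<lambda>x. r *\<^sub>R f x)"
instance ..
end

instance "fun" :: (type, real_vector) real_vector
  by standard (simp_all add: scaleR_fun_def fun_eq_iff algebra_simps)

text \<open>Only meant for open \<open>S\<close>. As the domain is finite-dimensional, it suffices to ask that all
  directional derivatives of \<open>f\<close> are of class \<open>C\<^sup>k\<close>, for every direction \<open>v\<close>.\<close>

primrec Ck_on :: "nat \<Rightarrow> 'a::euclidean_space set \<Rightarrow> ('a \<Rightarrow> 'b::real_normed_vector) \<Rightarrow> bool" where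
  "Ck_on 0 S f \<longleftrightarrow> continuous_on S f"
| "Ck_on (Suc k) S f \<longleftrightarrow>
     (\<forall>x\<in>S. f differentiable at x) \<and> (\<forall>v. Ck_on k S (\<lambda>x. frechet_derivative f (at x) v))"

definition smooth_on :: "'a::euclidean_space set \<Rightarrow> ('a \<Rightarrow> 'b::real_normed_vector) \<Rightarrow> bool"
  where "smooth_on S f \<longleftrightarrow> (\<forall>k. Ck_on k S f)"

text \<open>The points of a manifold form a whole (Hausdorff, second countable) topological type;
  the smooth structure is given by an atlas, which need not be maximal. The map of a chart
  \<open>(U, \<phi>)\<close> is only relevant on \<open>U\<close>.\<close>

type_synonym ('m, 'e) atlas = "('m set \<times> ('m \<Rightarrow> 'e)) set"

definition smooth_atlas ::
  "('m::{t2_space,second_countable_topology}, 'e::euclidean_space) atlas \<Rightarrow> bool"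
  where "smooth_atlas A \<longleftrightarrow>
    (\<Union>(U, \<phi>)\<in>A. U) = UNIV \<and>
    (\<forall>(U, \<phi>)\<in>A. open U \<and> open (\<phi> ` U) \<and> homeomorphism U (\<phi> ` U) \<phi> (inv_into U \<phi>)) \<and>
    (\<forall>(U, \<phi>)\<in>A. \<forall>(V, \<psi>)\<in>A. smooth_on (\<phi> ` (U \<inter> V)) (\<psi> \<circ> inv_into U \<phi>))"

definition smooth_map ::
  "('m::topological_space, 'e::euclidean_space) atlas \<Rightarrow>
   ('n::topological_space, 'f::euclidean_space) atlas \<Rightarrow> ('m \<Rightarrow> 'n) \<Rightarrow> bool"
  where "smooth_map A B h \<longleftrightarrow> continuous_on UNIV h \<and>
    (\<forall>(U, \<phi>)\<in>A. \<forall>(V, \<psi>)\<in>B. smooth_on (\<phi> ` (U \<inter> h -` V)) (\<psi> \<circ> h \<circ> inv_into U \<phi>))"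

definition product_atlas ::
  "('m, 'e) atlas \<Rightarrow> ('n, 'f) atlas \<Rightarrow> ('m \<times> 'n, 'e \<times> 'f) atlas"
  where "product_atlas A B = {(U \<times> V, map_prod \<phi> \<psi>) | U \<phi> V \<psi>. (U, \<phi>) \<in> A \<and> (V, \<psi>) \<in> B}"

definition smooth_fun ::
  "('m::topological_space, 'e::euclidean_space) atlas \<Rightarrow> ('m \<Rightarrow> real) \<Rightarrow> bool"
  where "smooth_fun A f \<longleftrightarrow> (\<forall>(U, \<phi>)\<in>A. smooth_on (\<phi> ` U) (f \<circ> inv_into U \<phi>))"

text \<open>The group operation is written \<open>+\<close>, since \<open>group_add\<close> is the library class of (not
  necessarily commutative) groups; no commutativity is assumed anywhere.\<close>

definition lie_group ::
  "('l::{t2_space,second_countable_topology,group_add}, 'e::euclidean_space) atlas \<Rightarrow> bool"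
  where "lie_group A \<longleftrightarrow> smooth_atlas A \<and>
    smooth_map (product_atlas A A) A (\<lambda>(a, b). a + b) \<and> smooth_map A A uminus"

text \<open>A tangent vector at \<open>p\<close> is a derivation at \<open>p\<close> of the algebra of smooth functions. In a
  logic of total functions it also takes values on non-smooth functions; these are fixed to
  be 0, so that equality of tangent vectors is equality of derivations.\<close>

type_synonym 'm tvec = "('m \<Rightarrow> real) \<Rightarrow> real"

definition tangent_space ::
  "('m::topological_space, 'e::euclidean_space) atlas \<Rightarrow> 'm \<Rightarrow> 'm tvec set"
  where "tangent_space A p = {v.
    (\<forall>f. \<not> smooth_fun A f \<longrightarrow> v f = 0) \<and>
    (\<forall>f h a b. smooth_fun A f \<and> smooth_fun A h \<longrightarrow>
       v (\<lambda>q. a * f q + b * h q) = a * v f + b * v h) \<and>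
    (\<forall>f h. smooth_fun A f \<and> smooth_fun A h \<longrightarrow>
       v (\<lambda>q. f q * h q) = v f * h p + f p * v h)}"

definition tangent_basis ::
  "('m::topological_space, 'e::euclidean_space) atlas \<Rightarrow> 'm \<Rightarrow> ('i \<Rightarrow> 'm tvec) \<Rightarrow> bool"
  where "tangent_basis A p b \<longleftrightarrow>
    inj b \<and> independent (range b) \<and> span (range b) = tangent_space A p"

type_synonym 'm vfield = "'m \<Rightarrow> 'm tvec"

definition vector_field ::
  "('m::topological_space, 'e::euclidean_space) atlas \<Rightarrow> 'm vfield \<Rightarrow> bool"
  where "vector_field A X \<longleftrightarrow> (\<forall>p. X p \<in> tangent_space A p) \<and>
    (\<forall>f. smooth_fun A f \<longrightarrow> smooth_fun A (\<lambda>p. X p f))"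

definition fmult :: "('m \<Rightarrow> real) \<Rightarrow> 'm vfield \<Rightarrow> 'm vfield"
  where "fmult f X = (\<lambda>p. f p *\<^sub>R X p)"

definition lie_bracket :: "'m vfield \<Rightarrow> 'm vfield \<Rightarrow> 'm vfield"
  where "lie_bracket X Y = (\<lambda>p f. X p (\<lambda>q. Y q f) - Y p (\<lambda>q. X q f))"

text \<open>The differential of the left translation by \<open>a\<close>, from the tangent space at any \<open>p\<close> to
  the one at \<open>a + p\<close>.\<close>

definition dleft :: "'l::group_add \<Rightarrow> 'l tvec \<Rightarrow> 'l tvec"
  where "dleft a v = (\<lambda>f. v (\<lambda>q. f (a + q)))"

definition left_invariant_field :: "'l::group_add vfield \<Rightarrow> bool"
  where "left_invariant_field X \<longleftrightarrow> (\<forall>a p. X (a + p) = dleft a (X p))"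

text \<open>Metrics and endomorphism fields are given pointwise; at \<open>p\<close> only their values on
  \<open>tangent_space A p\<close> are relevant.\<close>

type_synonym 'm metric = "'m \<Rightarrow> 'm tvec \<Rightarrow> 'm tvec \<Rightarrow> real"
type_synonym 'm endo = "'m \<Rightarrow> 'm tvec \<Rightarrow> 'm tvec"

definition pseudo_riemannian_metric ::
  "('m::topological_space, 'e::euclidean_space) atlas \<Rightarrow> 'm metric \<Rightarrow> bool"
  where "pseudo_riemannian_metric A g \<longleftrightarrow>
    (\<forall>p. \<forall>u\<in>tangent_space A p. \<forall>v\<in>tangent_space A p. g p u v = g p v u) \<and>
    (\<forall>p. \<forall>u\<in>tangent_space A p. \<forall>v\<in>tangent_space A p. \<forall>w\<in>tangent_space A p. \<forall>a b.
       g p (a *\<^sub>R u + b *\<^sub>R v) w = a * g p u w + b * g p v w) \<and>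
    (\<forall>p. \<forall>u\<in>tangent_space A p. (\<forall>v\<in>tangent_space A p. g p u v = 0) \<longrightarrow> u = 0) \<and>
    (\<forall>X Y. vector_field A X \<and> vector_field A Y \<longrightarrow> smooth_fun A (\<lambda>p. g p (X p) (Y p)))"

definition left_invariant_metric ::
  "('l::{topological_space,group_add}, 'e::euclidean_space) atlas \<Rightarrow> 'l metric \<Rightarrow> bool"
  where "left_invariant_metric A g \<longleftrightarrow>
    (\<forall>a p. \<forall>u\<in>tangent_space A p. \<forall>v\<in>tangent_space A p.
       g (a + p) (dleft a u) (dleft a v) = g p u v)"

definition affine_connection ::
  "('m::topological_space, 'e::euclidean_space) atlas \<Rightarrow>
   ('m vfield \<Rightarrow> 'm vfield \<Rightarrow> 'm vfield) \<Rightarrow> bool"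
  where "affine_connection A nab \<longleftrightarrow>
    (\<forall>X Y. vector_field A X \<and> vector_field A Y \<longrightarrow> vector_field A (nab X Y)) \<and>
    (\<forall>X Y Z. vector_field A X \<and> vector_field A Y \<and> vector_field A Z \<longrightarrow>
       nab (X + Y) Z = nab X Z + nab Y Z \<and> nab X (Y + Z) = nab X Y + nab X Z) \<and>
    (\<forall>f X Y. smooth_fun A f \<and> vector_field A X \<and> vector_field A Y \<longrightarrow>
       nab (fmult f X) Y = fmult f (nab X Y) \<and>
       nab X (fmult f Y) = fmult (\<lambda>p. X p f) Y + fmult f (nab X Y))"

definition levi_civita ::
  "('m::topological_space, 'e::euclidean_space) atlas \<Rightarrow> 'm metric \<Rightarrow>
   ('m vfield \<Rightarrow> 'm vfield \<Rightarrow> 'm vfield) \<Rightarrow> bool"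
  where "levi_civita A g nab \<longleftrightarrow> affine_connection A nab \<and>
    (\<forall>X Y. vector_field A X \<and> vector_field A Y \<longrightarrow> nab X Y - nab Y X = lie_bracket X Y) \<and>
    (\<forall>X Y Z p. vector_field A X \<and> vector_field A Y \<and> vector_field A Z \<longrightarrow>
       X p (\<lambda>q. g q (Y q) (Z q)) = g p (nab X Y p) (Z p) + g p (Y p) (nab X Z p))"

definition act :: "'m endo \<Rightarrow> 'm vfield \<Rightarrow> 'm vfield"
  where "act J X = (\<lambda>p. J p (X p))"

definition almost_complex_structure ::
  "('m::topological_space, 'e::euclidean_space) atlas \<Rightarrow> 'm endo \<Rightarrow> bool"
  where "almost_complex_structure A J \<longleftrightarrow>
    (\<forall>p. \<forall>u\<in>tangent_space A p. J p u \<in> tangent_space A p \<and> J p (J p u) = - u) \<and>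
    (\<forall>p. \<forall>u\<in>tangent_space A p. \<forall>v\<in>tangent_space A p. \<forall>a b.
       J p (a *\<^sub>R u + b *\<^sub>R v) = a *\<^sub>R J p u + b *\<^sub>R J p v) \<and>
    (\<forall>X. vector_field A X \<longrightarrow> vector_field A (act J X))"

definition left_invariant_endo ::
  "('l::{topological_space,group_add}, 'e::euclidean_space) atlas \<Rightarrow> 'l endo \<Rightarrow> bool"
  where "left_invariant_endo A J \<longleftrightarrow>
    (\<forall>a p. \<forall>u\<in>tangent_space A p. J (a + p) (dleft a u) = dleft a (J p u))"

text \<open>\<open>F(X,Y,Z) = g((\<nabla>\<^sub>X J) Y, Z)\<close>, as a function on the manifold, for vector fields
  \<open>X, Y, Z\<close>. It is tensorial, so ranging over vector fields and points amounts to
  ranging over tangent vectors.\<close>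

definition Ften ::
  "'m metric \<Rightarrow> ('m vfield \<Rightarrow> 'm vfield \<Rightarrow> 'm vfield) \<Rightarrow> 'm endo \<Rightarrow>
   'm vfield \<Rightarrow> 'm vfield \<Rightarrow> 'm vfield \<Rightarrow> 'm \<Rightarrow> real"
  where "Ften g nab J X Y Z p = g p ((nab X (act J Y) - act J (nab X Y)) p) (Z p)"

text \<open>The Lee form at \<open>p\<close>, computed in vector fields \<open>e i\<close> whose values at \<open>p\<close> are a basis of
  the tangent space there.\<close>

definition lee_form ::
  "'m metric \<Rightarrow> ('m vfield \<Rightarrow> 'm vfield \<Rightarrow> 'm vfield) \<Rightarrow> 'm endo \<Rightarrow>
   ('n::finite \<Rightarrow> 'm vfield) \<Rightarrow> 'm vfield \<Rightarrow> 'm \<Rightarrow> real"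
  where "lee_form g nab J e Z p =
    (\<Sum>i\<in>UNIV. \<Sum>j\<in>UNIV.
       matrix_inv (\<chi> i j. g p (e i p) (e j p)) $ i $ j * Ften g nab J (e i) (e j) Z p)"

text \<open>The dimension is \<open>CARD('n) = 4 * n\<close>, and the identity is required for every choice of
  the basis entering the Lee form.\<close>

definition class_W4 ::
  "('m::topological_space, real^'n::finite) atlas \<Rightarrow> 'm metric \<Rightarrow>
   ('m vfield \<Rightarrow> 'm vfield \<Rightarrow> 'm vfield) \<Rightarrow> 'm endo \<Rightarrow> bool"
  where "class_W4 A g nab J \<longleftrightarrow>
    (\<forall>p. \<forall>e :: 'n \<Rightarrow> 'm vfield.
       (\<forall>i. vector_field A (e i)) \<and> tangent_basis A p (\<lambda>i. e i p) \<longrightarrow>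
       (\<forall>X Y Z. vector_field A X \<and> vector_field A Y \<and> vector_field A Z \<longrightarrow>
          (let n = real CARD('n) / 4; \<theta> = (\<lambda>V. lee_form g nab J e V p) in
           Ften g nab J X Y Z p = 1 / (2 * (2 * n - 1)) *
             (g p (X p) (Y p) * \<theta> Z - g p (X p) (Z p) * \<theta> Y
              - g p (X p) (act J Y p) * \<theta> (act J Z)
              + g p (X p) (act J Z p) * \<theta> (act J Y)))))"

definition class_W3 ::
  "('m::topological_space, 'e::euclidean_space) atlas \<Rightarrow> 'm metric \<Rightarrow>
   ('m vfield \<Rightarrow> 'm vfield \<Rightarrow> 'm vfield) \<Rightarrow> 'm endo \<Rightarrow> bool"
  where "class_W3 A g nab J \<longleftrightarrow>
    (\<forall>X Y Z p. vector_field A X \<and> vector_field A Y \<and> vector_field A Z \<longrightarrow>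
       Ften g nab J X Y Z p + Ften g nab J Y Z X p + Ften g nab J Z X Y p = 0)"

end

(* The skew-symmetry g([X_i,X_j],X_k) + g([X_i,X_k],X_j) = 0 of the structure constants turns the
   Koszul formula into nabla_{X_i} X_j = 1/2 [X_i,X_j]. All members of the three identities are
   linear over smooth functions in each argument, and a vector field V is the combination of the X_i
   with the smooth coefficients g(X_i,X_i) g(V,X_i). So it suffices to check the identities on the
   frame, where they are linear identities in the parameters. The Lee form in an arbitrary
   basis is the contraction of F with the inverse metric, hence can be computed in the frame as well. *)

theory Submission
  imports Defs
begin

section \<open>Smooth functions\<close>

text \<open>Near a point of an open set, a derivative sees only values in that set. The sum and
  product rules describe \<open>frechet_derivative\<close> only at points of \<open>S\<close>, so
  this transfer closes their inductions.\<close>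

lemma Ck_on_cong:
  assumes "open S" "\<And>x. x \<in> S \<Longrightarrow> f x = h x"
  shows "Ck_on k S f \<longleftrightarrow> Ck_on k S h"
  using assms(2)
proof (induction k arbitrary: f h)
  case 0
  then show ?case by (simp cong: continuous_on_cong)
next
  case (Suc k)
  have has: "(f has_derivative d) (at x) \<longleftrightarrow> (h has_derivative d) (at x)" if "x \<in> S" for x d
    using has_derivative_transform_within_open[OF _ assms(1) that] Suc.prems by metis
  then have "frechet_derivative f (at x) = frechet_derivative h (at x)" if "x \<in> S" for x
    using that by (simp add: frechet_derivative_def)
  then have "Ck_on k S (\<lambda>x. frechet_derivative f (at x) v) =
      Ck_on k S (\<lambda>x. frechet_derivative h (at x) v)" for v
    by (intro Suc.IH) simp
  then show ?case
    using has by (simp add: differentiable_def)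
qed

lemma Ck_on_SucD: "Ck_on (Suc k) S f \<Longrightarrow> Ck_on k S f"
proof (induction k arbitrary: f)
  case 0
  then show ?case
    by (auto intro!: differentiable_imp_continuous_on differentiable_at_imp_differentiable_on)
next
  case (Suc k)
  then show ?case by (metis Ck_on.simps(2))
qed

lemma Ck_on_const: "Ck_on k S (\<lambda>x. c)"
proof (induction k arbitrary: c)
  case (Suc k)
  then show ?case by (simp add: frechet_derivative_const)
qed simp

lemma Ck_on_add:
  assumes "open S"
  shows "Ck_on k S f \<Longrightarrow> Ck_on k S h \<Longrightarrow> Ck_on k S (\<lambda>x. f x + h x)"
proof (induction k arbitrary: f h)
  case 0
  then show ?case by (simp add: continuous_on_add)
next
  case (Suc k)
  have "frechet_derivative (\<lambda>x. f x + h x) (at x) v =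
      frechet_derivative f (at x) v + frechet_derivative h (at x) v" if "x \<in> S" for x v
  proof -
    have "(f has_derivative frechet_derivative f (at x)) (at x)"
      "(h has_derivative frechet_derivative h (at x)) (at x)"
      using Suc.prems that by (simp_all flip: frechet_derivative_works)
    from frechet_derivative_at[OF has_derivative_add[OF this], symmetric] show ?thesis
      by simp
  qed
  then have "Ck_on k S (\<lambda>x. frechet_derivative (\<lambda>x. f x + h x) (at x) v)" for v
    using Ck_on_cong[OF assms, of "\<lambda>x. frechet_derivative (\<lambda>x. f x + h x) (at x) v"] Suc by simp
  with Suc.prems show ?case by simp
qed

lemma Ck_on_mult:
  fixes f h :: "'a::euclidean_space \<Rightarrow> 'b::real_normed_algebra"
  assumes "open S"
  shows "Ck_on k S f \<Longrightarrow> Ck_on k S h \<Longrightarrow> Ck_on k S (\<lambda>x. f x * h x)"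
proof (induction k arbitrary: f h)
  case 0
  then show ?case by (simp add: continuous_on_mult)
next
  case (Suc k)
  have "frechet_derivative (\<lambda>x. f x * h x) (at x) v =
      f x * frechet_derivative h (at x) v + frechet_derivative f (at x) v * h x" if "x \<in> S" for x v
  proof -
    have "(f has_derivative frechet_derivative f (at x)) (at x)"
      "(h has_derivative frechet_derivative h (at x)) (at x)"
      using Suc.prems that by (simp_all flip: frechet_derivative_works)
    from frechet_derivative_at[OF has_derivative_mult[OF this], symmetric] show ?thesis
      by simp
  qed
  moreover have "Ck_on k S (\<lambda>x. f x * frechet_derivative h (at x) v
      + frechet_derivative f (at x) v * h x)" for v
    \<comment> \<open>The undifferentiated factors of the Leibniz rule come with order
      \<open>Suc k\<close> and are lowered to order \<open>k\<close>.\<close>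
    using Suc.prems Suc.prems[THEN Ck_on_SucD] by (intro Ck_on_add[OF assms] Suc.IH) simp_all
  ultimately have "Ck_on k S (\<lambda>x. frechet_derivative (\<lambda>x. f x * h x) (at x) v)" for v
    using Ck_on_cong[OF assms, of "\<lambda>x. frechet_derivative (\<lambda>x. f x * h x) (at x) v"] by simp
  with Suc.prems show ?case by simp
qed

section \<open>The algebra of smooth functions on a manifold\<close>

lemma smooth_fun_const: "smooth_fun A (\<lambda>p. c)"
  by (simp add: smooth_fun_def smooth_on_def Ck_on_const comp_def split_def)

lemma smooth_fun_add:
  assumes "smooth_atlas A" "smooth_fun A f" "smooth_fun A h"
  shows "smooth_fun A (\<lambda>p. f p + h p)"
  using assms unfolding smooth_fun_def smooth_on_def smooth_atlas_def comp_def
  by (fastforce intro!: Ck_on_add)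

lemma smooth_fun_mult:
  assumes "smooth_atlas A" "smooth_fun A f" "smooth_fun A h"
  shows "smooth_fun A (\<lambda>p. f p * h p)"
  using assms unfolding smooth_fun_def smooth_on_def smooth_atlas_def comp_def
  by (fastforce intro!: Ck_on_mult)

section \<open>Vector fields and tensorial functionals\<close>

lemma scaleR_fun_apply [simp]: "(r *\<^sub>R f) x = r *\<^sub>R f x"
  by (simp add: scaleR_fun_def)

lemma vfield_apply [simp]:
  "(V + W) p = V p + W p" "(V - W) p = V p - W p" "(- V) p = - V p" "(0 :: 'm vfield) p = 0"
  for V W :: "'m vfield"
  by simp_all

lemma fmult_apply [simp]: "fmult f V p = f p *\<^sub>R V p"
  by (simp add: fmult_def)

lemma act_apply [simp]: "act J V p = J p (V p)"
  by (simp add: act_def)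

lemma lie_bracket_swap: "lie_bracket V W = - lie_bracket W V"
  by (simp add: lie_bracket_def fun_eq_iff)

lemma lie_bracket_self: "lie_bracket V V = 0"
  by (simp add: lie_bracket_def fun_eq_iff)

text \<open>Collects properties that are stable under composition, so that \<open>J3\<close>
  inherits them from \<open>J1\<close> and \<open>J2\<close>.\<close>

definition smooth_endo ::
  "('m::topological_space, 'e::euclidean_space) atlas \<Rightarrow> 'm endo \<Rightarrow> bool"
  where "smooth_endo A J \<longleftrightarrow>
    (\<forall>p. \<forall>u\<in>tangent_space A p. J p u \<in> tangent_space A p) \<and>
    (\<forall>p. \<forall>u\<in>tangent_space A p. \<forall>v\<in>tangent_space A p. \<forall>a b.
       J p (a *\<^sub>R u + b *\<^sub>R v) = a *\<^sub>R J p u + b *\<^sub>R J p v) \<and>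
    (\<forall>V. vector_field A V \<longrightarrow> vector_field A (act J V))"

lemma smooth_endo_almost_complex: "almost_complex_structure A J \<Longrightarrow> smooth_endo A J"
  by (simp add: almost_complex_structure_def smooth_endo_def)

lemma smooth_endo_comp:
  assumes "smooth_endo A J" "smooth_endo A K"
  shows "smooth_endo A (\<lambda>p. J p \<circ> K p)"
proof -
  have "act (\<lambda>p. J p \<circ> K p) V = act J (act K V)" for V
    by (simp add: act_def)
  then show ?thesis
    using assms by (simp add: smooth_endo_def)
qed

text \<open>Linearity over the smooth functions, evaluated at \<open>p\<close>. The argument is a
  field and not a tangent vector because a connection differentiates its second argument.\<close>

definition tensorial_at ::
  "('m::topological_space, 'e::euclidean_space) atlas \<Rightarrow> 'm \<Rightarrow> ('m vfield \<Rightarrow> real) \<Rightarrow> bool"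
  where "tensorial_at A p L \<longleftrightarrow>
    (\<forall>V W. vector_field A V \<and> vector_field A W \<longrightarrow> L (V + W) = L V + L W) \<and>
    (\<forall>f V. smooth_fun A f \<and> vector_field A V \<longrightarrow> L (fmult f V) = f p * L V)"

lemma tensorial_at_add:
  "tensorial_at A p L \<Longrightarrow> tensorial_at A p M \<Longrightarrow> tensorial_at A p (\<lambda>V. L V + M V)"
  by (simp add: tensorial_at_def algebra_simps)

lemma tensorial_at_diff:
  "tensorial_at A p L \<Longrightarrow> tensorial_at A p M \<Longrightarrow> tensorial_at A p (\<lambda>V. L V - M V)"
  by (simp add: tensorial_at_def algebra_simps)

lemma tensorial_at_mult_left: "tensorial_at A p L \<Longrightarrow> tensorial_at A p (\<lambda>V. c * L V)"
  by (simp add: tensorial_at_def algebra_simps)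

lemma tensorial_at_mult_right: "tensorial_at A p L \<Longrightarrow> tensorial_at A p (\<lambda>V. L V * c)"
  by (simp add: tensorial_at_def algebra_simps)

lemma tensorial_at_sum:
  "(\<And>i. i \<in> S \<Longrightarrow> tensorial_at A p (L i)) \<Longrightarrow> tensorial_at A p (\<lambda>V. \<Sum>i\<in>S. L i V)"
  by (simp add: tensorial_at_def sum.distrib sum_distrib_left)

section \<open>Orthonormal frames\<close>

text \<open>The frame is global, so the coefficients of a vector field are smooth on the whole
  manifold and can be pulled out of tensorial functionals without cutoff functions.\<close>

locale orthonormal_frame =
  fixes A :: "('m::{t2_space,second_countable_topology}, 'e::euclidean_space) atlas"
    and X :: "'i::finite \<Rightarrow> 'm vfield"
    and g :: "'m metric"
    and \<epsilon> :: "'i \<Rightarrow> real"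
  assumes smooth_atlas: "smooth_atlas A"
    and frame_field: "\<And>i. vector_field A (X i)"
    and frame_basis: "\<And>p. tangent_basis A p (\<lambda>i. X i p)"
    and metric: "pseudo_riemannian_metric A g"
    and orthonormal: "\<And>p i j. g p (X i p) (X j p) = (if i = j then \<epsilon> i else 0)"
    and sign_square: "\<And>i. \<epsilon> i * \<epsilon> i = 1"
begin

text \<open>Read off from the frame: the tangent space is a span.\<close>

lemma subspace_tangent_space: "subspace (tangent_space A p)"
  using frame_basis[of p] unfolding tangent_basis_def by (metis subspace_span)

lemmas tangent_closed [intro, simp] =
  subspace_add[OF subspace_tangent_space] subspace_diff[OF subspace_tangent_space]
  subspace_neg[OF subspace_tangent_space] subspace_scale[OF subspace_tangent_space]
  subspace_0[OF subspace_tangent_space] subspace_sum[OF subspace_tangent_space]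

lemma vector_field_tangent [simp]: "vector_field A V \<Longrightarrow> V p \<in> tangent_space A p"
  by (simp add: vector_field_def)

lemma frame_tangent [simp]: "X i p \<in> tangent_space A p"
  using frame_field by simp

section \<open>Vector fields as a module over the smooth functions\<close>

lemma vector_field_add [simp]:
  "vector_field A V \<Longrightarrow> vector_field A W \<Longrightarrow> vector_field A (V + W)"
  using smooth_fun_add[OF smooth_atlas] by (simp add: vector_field_def)

lemma vector_field_fmult [simp]:
  "smooth_fun A f \<Longrightarrow> vector_field A V \<Longrightarrow> vector_field A (fmult f V)"
  using smooth_fun_mult[OF smooth_atlas] by (simp add: vector_field_def scaleR_fun_apply)

lemma vector_field_scaleR [simp]: "vector_field A V \<Longrightarrow> vector_field A (r *\<^sub>R V)"
  using vector_field_fmult[OF smooth_fun_const, of V r] by (simp add: fmult_def scaleR_fun_def)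

lemma vector_field_minus [simp]: "vector_field A V \<Longrightarrow> vector_field A (- V)"
  using vector_field_scaleR[of V "-1"] by (simp del: vector_field_scaleR)

lemma vector_field_diff [simp]:
  "vector_field A V \<Longrightarrow> vector_field A W \<Longrightarrow> vector_field A (V - W)"
  using vector_field_add[of V "- W"] by simp

lemma vector_field_0 [simp]: "vector_field A 0"
  using vector_field_scaleR[OF frame_field, of 0] by simp

section \<open>Bilinearity of the metric on tangent spaces\<close>

lemma metric_sym:
  "u \<in> tangent_space A p \<Longrightarrow> v \<in> tangent_space A p \<Longrightarrow> g p u v = g p v u"
  using metric by (simp add: pseudo_riemannian_metric_def)

lemma metric_lincomb_left:
  "u \<in> tangent_space A p \<Longrightarrow> v \<in> tangent_space A p \<Longrightarrow> w \<in> tangent_space A p \<Longrightarrow>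
    g p (a *\<^sub>R u + b *\<^sub>R v) w = a * g p u w + b * g p v w"
  using metric unfolding pseudo_riemannian_metric_def by blast

lemma metric_left:
  assumes "u \<in> tangent_space A p" "v \<in> tangent_space A p" "w \<in> tangent_space A p"
  shows "g p (u + v) w = g p u w + g p v w" "g p (u - v) w = g p u w - g p v w"
  using metric_lincomb_left[OF assms, of 1 1] metric_lincomb_left[OF assms, of 1 "-1"] by simp_all

lemma metric_scale_left:
  assumes "u \<in> tangent_space A p" "w \<in> tangent_space A p"
  shows "g p (r *\<^sub>R u) w = r * g p u w" "g p (- u) w = - g p u w"
  using metric_lincomb_left[OF assms(1,1,2), of r 0] metric_lincomb_left[OF assms(1,1,2), of "-1" 0]
  by simp_all

lemma metric_zero_left: "w \<in> tangent_space A p \<Longrightarrow> g p 0 w = 0"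
  using metric_scale_left(1)[of 0 p w 0] by simp

lemma metric_right:
  assumes "u \<in> tangent_space A p" "v \<in> tangent_space A p" "w \<in> tangent_space A p"
  shows "g p w (u + v) = g p w u + g p w v" "g p w (u - v) = g p w u - g p w v"
  using assms metric_left[OF assms] metric_sym[of w p] by simp_all

lemma metric_scale_right:
  assumes "u \<in> tangent_space A p" "w \<in> tangent_space A p"
  shows "g p w (r *\<^sub>R u) = r * g p w u" "g p w (- u) = - g p w u"
  using assms metric_scale_left[OF assms] metric_sym[of w p] by simp_all

lemma metric_sum_left:
  assumes "\<And>i. i \<in> S \<Longrightarrow> u i \<in> tangent_space A p" "w \<in> tangent_space A p"
  shows "g p (\<Sum>i\<in>S. u i) w = (\<Sum>i\<in>S. g p (u i) w)"
  using assms(1)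
proof (induction S rule: infinite_finite_induct)
  case (insert i S)
  have "u i \<in> tangent_space A p" and S: "(\<Sum>i\<in>S. u i) \<in> tangent_space A p"
    using insert.prems by blast+
  moreover have "g p (\<Sum>i\<in>S. u i) w = (\<Sum>i\<in>S. g p (u i) w)"
    using insert.IH insert.prems by blast
  ultimately show ?case
    using insert.hyps metric_left(1)[OF _ S assms(2)] by (simp only: sum.insert simp_thms)
qed (simp_all only: sum.infinite sum.empty finite.emptyI metric_zero_left[OF assms(2)] not_False_eq_True)

text \<open>As \<open>\<epsilon> i = \<plusminus>1\<close>, the factor \<open>\<epsilon> i\<close> stands for division by \<open>g (X i) (X i)\<close>.\<close>

definition coord :: "'m vfield \<Rightarrow> 'i \<Rightarrow> 'm \<Rightarrow> real"
  where "coord V i = (\<lambda>p. \<epsilon> i * g p (V p) (X i p))"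

lemma smooth_coord [simp]: "vector_field A V \<Longrightarrow> smooth_fun A (coord V i)"
  unfolding coord_def using metric frame_field
  by (intro smooth_fun_mult[OF smooth_atlas] smooth_fun_const)
    (simp add: pseudo_riemannian_metric_def)

text \<open>Pairing a combination of the frame with \<open>X j p\<close> leaves the
  \<open>j\<close>-th coefficient times \<open>\<epsilon> j\<close>, and a second factor
  \<open>\<epsilon> j\<close> removes the sign.\<close>

lemma tangent_eq_sum_frame:
  assumes "u \<in> tangent_space A p"
  shows "u = (\<Sum>i\<in>UNIV. (\<epsilon> i * g p u (X i p)) *\<^sub>R X i p)"
proof -
  have "u \<in> span (range (\<lambda>i. X i p))" and inj: "inj (\<lambda>i. X i p)"
    using assms frame_basis[of p] by (simp_all add: tangent_basis_def)
  then obtain c where c: "u = (\<Sum>v\<in>range (\<lambda>i. X i p). c v *\<^sub>R v)"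
    by (auto simp: span_finite)
  \<comment> \<open>The coefficients supplied by the span are indexed by vectors; injectivity of the
    frame reindexes them by \<open>i\<close>.\<close>
  then have u: "u = (\<Sum>i\<in>UNIV. c (X i p) *\<^sub>R X i p)"
    by (simp add: sum.reindex[OF inj])
  have "g p u (X j p) = c (X j p) * \<epsilon> j" for j
    by (subst u, subst metric_sum_left)
      (simp_all add: metric_scale_left orthonormal if_distrib[of "\<lambda>x. _ * x"] cong: if_cong)
  then have "\<epsilon> j * g p u (X j p) = c (X j p)" for j
    using sign_square[of j] by (simp add: mult.left_commute)
  then show ?thesis
    using u by simp
qed

lemma tangent_eqI:
  assumes "u \<in> tangent_space A p" "v \<in> tangent_space A p"
    and "\<And>i. g p u (X i p) = g p v (X i p)"
  shows "u = v"
  using tangent_eq_sum_frame[OF assms(1)] tangent_eq_sum_frame[OF assms(2)] assms(3) by simp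

lemma sum_vfield_apply: "(\<Sum>i\<in>S. V i) p = (\<Sum>i\<in>S. V i p)" for V :: "'b \<Rightarrow> 'm vfield"
  by (induction S rule: infinite_finite_induct) simp_all

lemma vector_field_eq_sum_frame:
  assumes "vector_field A V"
  shows "V = (\<Sum>i\<in>UNIV. fmult (coord V i) (X i))"
proof
  fix p
  show "V p = (\<Sum>i\<in>UNIV. fmult (coord V i) (X i)) p"
    using tangent_eq_sum_frame[of "V p" p] assms
    by (simp add: sum_vfield_apply coord_def)
qed

text \<open>The frame expansion of \<open>V\<close> is passed through \<open>L\<close> term by term;
  each coefficient function leaves \<open>L\<close> as its value at \<open>p\<close>.\<close>

lemma tensorial_at_expand:
  assumes L: "tensorial_at A p L" and V: "vector_field A V"
  shows "L V = (\<Sum>i\<in>UNIV. coord V i p * L (X i))"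
proof -
  \<comment> \<open>Additivity of \<open>L\<close> is available for vector fields only, so the
    induction also carries that the partial sums are vector fields.\<close>
  have "vector_field A (\<Sum>i\<in>S. fmult (coord V i) (X i)) \<and>
      L (\<Sum>i\<in>S. fmult (coord V i) (X i)) = (\<Sum>i\<in>S. coord V i p * L (X i))" for S
    using finite[of S]
  proof (induction S rule: finite_induct)
    case empty
    \<comment> \<open>Writing the zero field as a zero multiple of \<open>V\<close> yields
      \<open>L 0 = 0\<close> from homogeneity.\<close>
    have "fmult (\<lambda>p. 0) V = 0"
      by (simp add: fun_eq_iff)
    then have "L 0 = 0"
      using L V smooth_fun_const[of A 0] unfolding tensorial_at_def by (metis mult_zero_left)
    then show ?case
      by (simp only: sum.empty vector_field_0 simp_thms)
  next
    case (insert i S)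
    then show ?case
      using L V frame_field
      by (simp only: sum.insert tensorial_at_def vector_field_add vector_field_fmult smooth_coord simp_thms)
  qed
  then show ?thesis
    using vector_field_eq_sum_frame[OF V] by metis
qed

text \<open>Expanding the third, the second and the first argument in turn reduces \<open>T\<close>
  to its values on frame triples.\<close>

lemma trilinear_vanishes:
  assumes V: "vector_field A V" and W: "vector_field A W" and Z: "vector_field A Z"
    and "\<And>W Z. vector_field A W \<Longrightarrow> vector_field A Z \<Longrightarrow> tensorial_at A p (\<lambda>V. T V W Z)"
    and "\<And>V Z. vector_field A V \<Longrightarrow> vector_field A Z \<Longrightarrow> tensorial_at A p (\<lambda>W. T V W Z)"
    and "\<And>V W. vector_field A V \<Longrightarrow> vector_field A W \<Longrightarrow> tensorial_at A p (T V W)"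
    and "\<And>i j k. T (X i) (X j) (X k) = 0"
  shows "T V W Z = 0"
proof -
  have "T (X i) (X j) Z = 0" for i j
    using tensorial_at_expand[OF assms(6) Z] assms(7) frame_field by simp
  then have "T (X i) W Z = 0" for i
    using tensorial_at_expand[OF assms(5) W] Z frame_field by simp
  then show ?thesis
    using tensorial_at_expand[OF assms(4) V] W Z by simp
qed

lemma tensorial_metric_left: "vector_field A W \<Longrightarrow> tensorial_at A p (\<lambda>V. g p (V p) (W p))"
  by (simp add: tensorial_at_def metric_left metric_scale_left)

lemma tensorial_metric_right: "vector_field A V \<Longrightarrow> tensorial_at A p (\<lambda>W. g p (V p) (W p))"
  by (simp add: tensorial_at_def metric_right metric_scale_right)

section \<open>Linearity of endomorphism fields\<close>

lemma endo_linear: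
  assumes "smooth_endo A J" "u \<in> tangent_space A p" "v \<in> tangent_space A p"
  shows "J p (u + v) = J p u + J p v" "J p (u - v) = J p u - J p v"
proof -
  have *: "J p (a *\<^sub>R u + b *\<^sub>R v) = a *\<^sub>R J p u + b *\<^sub>R J p v" for a b
    using assms unfolding smooth_endo_def by blast
  show "J p (u + v) = J p u + J p v" "J p (u - v) = J p u - J p v"
    using *[of 1 1] *[of 1 "-1"] by simp_all
qed

lemma endo_scale:
  assumes "smooth_endo A J" "u \<in> tangent_space A p"
  shows "J p (r *\<^sub>R u) = r *\<^sub>R J p u" "J p (- u) = - J p u"
proof -
  have *: "J p (a *\<^sub>R u + b *\<^sub>R u) = a *\<^sub>R J p u + b *\<^sub>R J p u" for a b
    using assms unfolding smooth_endo_def by blast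
  show "J p (r *\<^sub>R u) = r *\<^sub>R J p u" "J p (- u) = - J p u"
    using *[of r 0] *[of "-1" 0] by simp_all
qed

lemma endo_zero: "smooth_endo A J \<Longrightarrow> J p 0 = 0"
  using endo_scale(1)[of J 0 p 0] by simp

lemma vector_field_act [simp]: "smooth_endo A J \<Longrightarrow> vector_field A V \<Longrightarrow> vector_field A (act J V)"
  by (simp add: smooth_endo_def)

lemma act_add:
  "smooth_endo A J \<Longrightarrow> vector_field A V \<Longrightarrow> vector_field A W \<Longrightarrow> act J (V + W) = act J V + act J W"
  by (rule ext) (simp only: act_apply vfield_apply endo_linear vector_field_tangent)

lemma act_fmult:
  "smooth_endo A J \<Longrightarrow> vector_field A V \<Longrightarrow> act J (fmult f V) = fmult f (act J V)"
  by (rule ext) (simp only: act_apply fmult_apply endo_scale vector_field_tangent)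

lemma tensorial_at_act:
  "tensorial_at A p L \<Longrightarrow> smooth_endo A J \<Longrightarrow> tensorial_at A p (\<lambda>V. L (act J V))"
  by (simp add: tensorial_at_def act_add act_fmult)

end

section \<open>The Levi-Civita connection in an orthonormal frame\<close>

text \<open>Here \<open>P\<close> is a change of basis, \<open>D\<close> the Gram matrix of the
  frame (its own inverse) and \<open>B\<close> a bilinear form in the frame. The inverse of the new
  Gram matrix absorbs both factors \<open>P\<close>, so the contraction is unchanged.\<close>

lemma contraction_basis_independent:
  fixes P Q D B :: "real^'n^'n"
  assumes "Q ** P = mat 1" "D ** D = mat 1"
  shows "(\<Sum>i\<in>UNIV. \<Sum>j\<in>UNIV. matrix_inv (P ** D ** transpose P) $ i $ j *
      (P ** B ** transpose P) $ i $ j) = (\<Sum>i\<in>UNIV. \<Sum>j\<in>UNIV. D $ i $ j * B $ i $ j)"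
proof -
  let ?G = "P ** D ** transpose P"
  define M where "M = matrix_inv ?G"
  have "P ** Q = mat 1"
    using assms(1) matrix_left_right_inverse by blast
  then have "transpose Q ** transpose P = mat 1"
    by (metis matrix_transpose_mul transpose_mat)
  then have "invertible P" "invertible (transpose P)" "invertible D"
    using assms \<open>P ** Q = mat 1\<close> by (metis invertible_def matrix_left_right_inverse)+
  then have "invertible ?G"
    by (simp add: invertible_mult)
  then have "?G ** M = mat 1"
    unfolding M_def matrix_inv_def invertible_def by (rule someI2_ex) blast+
  \<comment> \<open>The right inverse of the square matrix \<open>P\<close> found here is also a
    left inverse. Multiplying by \<open>D\<close> then expresses \<open>D\<close> through
    \<open>M\<close>.\<close>
  then have "P ** (D ** transpose P ** M) = mat 1"
    by (simp add: matrix_mul_assoc)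
  then have "D ** transpose P ** M ** P = mat 1"
    using matrix_left_right_inverse by blast
  then have "D ** (D ** (transpose P ** M ** P)) = D"
    by (simp add: matrix_mul_assoc)
  then have D: "D = transpose P ** M ** P"
    using assms(2) by (simp add: matrix_mul_assoc)
  \<comment> \<open>The double sum is a trace; cyclic invariance moves \<open>transpose P\<close> to
    the front, where \<open>transpose D\<close> can be recognized.\<close>
  have "(\<Sum>i\<in>UNIV. \<Sum>j\<in>UNIV. M $ i $ j * (P ** B ** transpose P) $ i $ j) =
      trace (transpose M ** (P ** B ** transpose P))"
    unfolding trace_def matrix_matrix_mult_def transpose_def
    by (simp, subst sum.swap, simp)
  also have "\<dots> = trace (transpose P ** (transpose M ** P ** B))"
    using trace_mul_sym[of "transpose P" "transpose M ** P ** B"] by (simp add: matrix_mul_assoc)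
  also have "\<dots> = trace (transpose D ** B)"
    unfolding D by (simp add: matrix_transpose_mul matrix_mul_assoc)
  also have "\<dots> = (\<Sum>i\<in>UNIV. \<Sum>j\<in>UNIV. D $ i $ j * B $ i $ j)"
    unfolding trace_def matrix_matrix_mult_def transpose_def
    by (simp, subst sum.swap, simp)
  finally show ?thesis
    unfolding M_def .
qed

locale levi_civita_frame = orthonormal_frame A X g \<epsilon>
  for A :: "('m::{t2_space,second_countable_topology}, 'e::euclidean_space) atlas"
    and X :: "'i::finite \<Rightarrow> 'm vfield" and g and \<epsilon> +
  fixes nab :: "'m vfield \<Rightarrow> 'm vfield \<Rightarrow> 'm vfield"
  assumes nabla: "levi_civita A g nab"
begin

section \<open>Rules for the Levi-Civita connection\<close>

lemma connection: "affine_connection A nab"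
  using nabla by (simp add: levi_civita_def)

lemma vector_field_nab [simp]:
  "vector_field A V \<Longrightarrow> vector_field A W \<Longrightarrow> vector_field A (nab V W)"
  using connection by (simp add: affine_connection_def)

lemma nab_add:
  assumes "vector_field A V" "vector_field A V'" "vector_field A W"
  shows "nab (V + V') W = nab V W + nab V' W" "nab W (V + V') = nab W V + nab W V'"
  using connection assms by (simp_all add: affine_connection_def)

lemma nab_fmult:
  assumes "smooth_fun A f" "vector_field A V" "vector_field A W"
  shows "nab (fmult f V) W = fmult f (nab V W)"
    "nab V (fmult f W) = fmult (\<lambda>p. V p f) W + fmult f (nab V W)"
  using connection assms by (simp_all add: affine_connection_def)

lemma nab_minus_right:
  assumes "vector_field A V" "vector_field A W"
  shows "nab V (- W) = - nab V W"
proof -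
  have "nab V 0 = 0"
    using nab_add(2)[of 0 0 V] assms by simp
  then show ?thesis
    using nab_add(2)[of W "- W" V] assms by (simp add: eq_neg_iff_add_eq_0 add.commute)
qed

lemma torsion_free:
  "vector_field A V \<Longrightarrow> vector_field A W \<Longrightarrow> nab V W - nab W V = lie_bracket V W"
  using nabla by (simp add: levi_civita_def)

lemma metric_compatible:
  "vector_field A U \<Longrightarrow> vector_field A V \<Longrightarrow> vector_field A W \<Longrightarrow>
    U p (\<lambda>q. g q (V q) (W q)) = g p (nab U V p) (W p) + g p (V p) (nab U W p)"
  using nabla by (simp add: levi_civita_def)

section \<open>Tensoriality of F and of the Lee form\<close>

lemma Ften_eq:
  assumes "smooth_endo A J" "vector_field A U" "vector_field A V" "vector_field A W"
  shows "Ften g nab J U V W p =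
    g p (nab U (act J V) p) (W p) - g p (act J (nab U V) p) (W p)"
  unfolding Ften_def vfield_apply using assms
  by (intro metric_left) (simp_all del: act_apply)

lemma tensorial_Ften_1:
  assumes "smooth_endo A J" "vector_field A V" "vector_field A W"
  shows "tensorial_at A p (\<lambda>U. Ften g nab J U V W p)"
proof -
  have "Ften g nab J (U + U') V W p = Ften g nab J U V W p + Ften g nab J U' V W p"
    if "vector_field A U" "vector_field A U'" for U U'
    using assms that
    by (simp del: act_apply add: Ften_eq nab_add act_add metric_left)
  moreover have "Ften g nab J (fmult f U) V W p = f p * Ften g nab J U V W p"
    if "smooth_fun A f" "vector_field A U" for f U
    using assms that
    by (simp del: act_apply add: Ften_eq nab_fmult act_fmult metric_scale_left right_diff_distrib)
  ultimately show ?thesis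
    by (simp add: tensorial_at_def)
qed

text \<open>For \<open>fmult f V\<close>, both \<open>nab U (act J V)\<close> and
  \<open>act J (nab U V)\<close> acquire the same Leibniz term, the derivative of \<open>f\<close>
  along \<open>U\<close> times \<open>act J V\<close>, and these cancel.\<close>

lemma tensorial_Ften_2:
  assumes "smooth_endo A J" "vector_field A U" "vector_field A W"
  shows "tensorial_at A p (\<lambda>V. Ften g nab J U V W p)"
proof -
  have "Ften g nab J U (V + V') W p = Ften g nab J U V W p + Ften g nab J U V' W p"
    if "vector_field A V" "vector_field A V'" for V V'
    using assms that
    by (simp del: act_apply add: Ften_eq nab_add act_add metric_left)
  moreover have "Ften g nab J U (fmult f V) W p = f p * Ften g nab J U V W p"
    if "smooth_fun A f" "vector_field A V" for f V
  proof -
    \<comment> \<open>Smoothness of this derivative makes the Leibniz term a vector field, as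
      \<open>act_add\<close> requires.\<close>
    have "smooth_fun A (\<lambda>p. U p f)"
      using assms(2) that(1) by (simp add: vector_field_def)
    then show ?thesis
      using assms that
      by (simp del: act_apply add: Ften_eq nab_fmult act_add act_fmult metric_left metric_scale_left
          right_diff_distrib)
  qed
  ultimately show ?thesis
    by (simp add: tensorial_at_def)
qed

lemma tensorial_Ften_3:
  assumes "smooth_endo A J" "vector_field A U" "vector_field A V"
  shows "tensorial_at A p (\<lambda>W. Ften g nab J U V W p)"
  unfolding Ften_def
  by (rule tensorial_metric_right) (intro vector_field_diff vector_field_nab vector_field_act assms)

lemma tensorial_lee_form:
  assumes "smooth_endo A J" "\<And>i. vector_field A (e i)"
  shows "tensorial_at A p (\<lambda>Z. lee_form g nab J e Z p)"
  unfolding lee_form_def using assms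
  by (intro tensorial_at_sum tensorial_at_mult_left tensorial_Ften_3)

text \<open>The matrix statement \<open>contraction_basis_independent\<close> is applied with
  \<open>P\<close> the frame coordinates of the \<open>e i\<close> at \<open>p\<close>. In the frame
  the inverse metric is diagonal with entries \<open>\<epsilon> i\<close>, so only diagonal terms of
  F survive.\<close>

lemma lee_form_frame:
  fixes e :: "'i \<Rightarrow> 'm vfield"
  assumes J: "smooth_endo A J" and e: "\<And>i. vector_field A (e i)"
    and basis: "tangent_basis A p (\<lambda>i. e i p)" and Z: "vector_field A Z"
  shows "lee_form g nab J e Z p = (\<Sum>i\<in>UNIV. \<epsilon> i * Ften g nab J (X i) (X i) Z p)"
proof -
  define P :: "real^'i^'i" where "P = (\<chi> i a. coord (e i) a p)"
  define D :: "real^'i^'i" where "D = (\<chi> a b. if a = b then \<epsilon> a else 0)"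
  define B :: "real^'i^'i" where "B = (\<chi> a b. Ften g nab J (X a) (X b) Z p)"
  have "\<exists>c. X a p = (\<Sum>i\<in>UNIV. c i *\<^sub>R e i p)" for a
  proof -
    have "X a p \<in> span (range (\<lambda>i. e i p))" and inj: "inj (\<lambda>i. e i p)"
      using basis by (simp_all add: tangent_basis_def)
    then obtain c where "X a p = (\<Sum>v\<in>range (\<lambda>i. e i p). c v *\<^sub>R v)"
      by (auto simp: span_finite)
    then show ?thesis
      by (auto simp: sum.reindex[OF inj])
  qed
  then obtain c where c: "\<And>a. X a p = (\<Sum>i\<in>UNIV. c a i *\<^sub>R e i p)"
    by metis
  define Q :: "real^'i^'i" where "Q = (\<chi> a i. c a i)"
  \<comment> \<open>Pairing the expansion of \<open>X a p\<close> in the basis \<open>e i p\<close>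
    with \<open>X b p\<close> shows that \<open>Q\<close> is a left inverse of
    \<open>P\<close>.\<close>
  have "(\<Sum>i\<in>UNIV. c a i * coord (e i) b p) = (if a = b then 1 else 0)" for a b
  proof -
    have "(\<Sum>i\<in>UNIV. c a i * coord (e i) b p) = \<epsilon> b * g p (\<Sum>i\<in>UNIV. c a i *\<^sub>R e i p) (X b p)"
      using e by (subst metric_sum_left)
        (simp_all add: coord_def metric_scale_left sum_distrib_left mult.left_commute)
    also have "\<dots> = \<epsilon> b * g p (X a p) (X b p)"
      by (simp flip: c)
    finally show ?thesis
      by (simp add: orthonormal sign_square)
  qed
  then have QP: "Q ** P = mat 1"
    by (simp add: Q_def P_def matrix_matrix_mult_def mat_def)
  have DD: "D ** D = mat 1"
    by (simp add: D_def matrix_matrix_mult_def mat_def vec_eq_iff if_distrib[of "\<lambda>x. x * _"]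
        sign_square cong: if_cong)
  \<comment> \<open>The nested form of the sum is the one produced by expanding first
    \<open>e i\<close> and then \<open>e j\<close> in the frame.\<close>
  have conj: "(P ** C ** transpose P) $ i $ j =
      (\<Sum>a\<in>UNIV. coord (e i) a p * (\<Sum>b\<in>UNIV. coord (e j) b p * C $ a $ b))" for C i j
    unfolding P_def matrix_matrix_mult_def transpose_def
    by (simp add: sum_distrib_left sum_distrib_right, subst sum.swap, simp add: algebra_simps)
  have "(\<chi> i j. g p (e i p) (e j p)) = P ** D ** transpose P"
  proof (simp add: vec_eq_iff conj, intro allI)
    fix i j
    have "g p (e i p) (e j p) = (\<Sum>a\<in>UNIV. coord (e i) a p * g p (X a p) (e j p))"
      by (rule tensorial_at_expand[OF tensorial_metric_left e]) (rule e)
    also have "\<dots> = (\<Sum>a\<in>UNIV. coord (e i) a p * (\<Sum>b\<in>UNIV. coord (e j) b p * g p (X a p) (X b p)))"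
      by (subst tensorial_at_expand[OF tensorial_metric_right e]) (simp_all add: frame_field)
    finally show "g p (e i p) (e j p) =
        (\<Sum>a\<in>UNIV. coord (e i) a p * (\<Sum>b\<in>UNIV. coord (e j) b p * D $ a $ b))"
      by (simp add: D_def orthonormal)
  qed
  moreover have "Ften g nab J (e i) (e j) Z p = (P ** B ** transpose P) $ i $ j" for i j
  proof -
    have "Ften g nab J (e i) (e j) Z p = (\<Sum>a\<in>UNIV. coord (e i) a p * Ften g nab J (X a) (e j) Z p)"
      by (rule tensorial_at_expand[OF tensorial_Ften_1 e]) (use J e Z in auto)
    also have "\<dots> = (\<Sum>a\<in>UNIV. coord (e i) a p *
        (\<Sum>b\<in>UNIV. coord (e j) b p * Ften g nab J (X a) (X b) Z p))"
      by (subst tensorial_at_expand[OF tensorial_Ften_2 e]) (use J Z frame_field in auto)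
    finally show ?thesis
      by (simp add: conj B_def)
  qed
  ultimately have "lee_form g nab J e Z p = (\<Sum>i\<in>UNIV. \<Sum>j\<in>UNIV.
      matrix_inv (P ** D ** transpose P) $ i $ j * (P ** B ** transpose P) $ i $ j)"
    by (simp add: lee_form_def)
  also have "\<dots> = (\<Sum>i\<in>UNIV. \<epsilon> i * Ften g nab J (X i) (X i) Z p)"
    unfolding contraction_basis_independent[OF QP DD]
    by (simp add: D_def B_def if_distrib[of "\<lambda>x. x * _"] cong: if_cong)
  finally show ?thesis .
qed

text \<open>The frame has constant scalar products, so the derivative terms of the Koszul formula
  vanish; of its three bracket terms, skewness cancels two and leaves the bracket of
  \<open>X i\<close> and \<open>X j\<close>.\<close>

lemma nab_frame:
  assumes skew: "\<And>i j k p. g p (lie_bracket (X i) (X j) p) (X k p) +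
      g p (lie_bracket (X i) (X k) p) (X j p) = 0"
  shows "nab (X i) (X j) = (1/2) *\<^sub>R lie_bracket (X i) (X j)"
proof
  fix p
  have bracket_field: "vector_field A (lie_bracket (X i) (X j))"
    using vector_field_diff[of "nab (X i) (X j)" "nab (X j) (X i)"]
    by (simp only: torsion_free vector_field_nab frame_field)
  have const: "X i p (\<lambda>q. c) = 0" for i c
  proof -
    \<comment> \<open>The Leibniz rule on the product of 1 with itself shows that derivations kill
      1, and linearity extends this to every constant.\<close>
    have "X i p (\<lambda>q. 1 * 1) = X i p (\<lambda>q. 1) * 1 + 1 * X i p (\<lambda>q. 1)"
      and lin: "X i p (\<lambda>q. c * 1 + 0 * 1) = c * X i p (\<lambda>q. 1) + 0 * X i p (\<lambda>q. 1)"
      using frame_tangent[of i p] smooth_fun_const[of A 1]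
      unfolding tangent_space_def by blast+
    then show ?thesis
      by simp
  qed
  define G where "G i j k = g p (nab (X i) (X j) p) (X k p)" for i j k
  have G_skew: "G i j k + G i k j = 0" for i j k
    using metric_compatible[of "X i" "X j" "X k" p] metric_sym[of "X j p" p "nab (X i) (X k) p"]
    by (simp add: G_def frame_field orthonormal const)
  have G_bracket: "g p (lie_bracket (X i) (X j) p) (X k p) = G i j k - G j i k" for i j k
    by (simp add: G_def frame_field metric_left flip: torsion_free)
  \<comment> \<open>With c i j k the bracket term of \<open>G_bracket\<close>, skewness of
    \<open>G\<close> gives 2 G i j k = c i j k - c j k i + c k i j, and skewness of the brackets
    makes the last two terms cancel.\<close>
  have "2 * G i j k = G i j k - G j i k" for k
    using G_skew[of i j k] G_skew[of j i k] G_skew[of k i j]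
      skew[of p i j k] skew[of p j i k] skew[of p k i j] unfolding G_bracket by linarith
  then have "g p (nab (X i) (X j) p) (X k p) = g p (((1/2) *\<^sub>R lie_bracket (X i) (X j)) p) (X k p)"
    for k
    using G_bracket[of i j k] G_def[of i j k]
    using bracket_field by (simp add: metric_scale_left)
  then show "nab (X i) (X j) p = ((1/2) *\<^sub>R lie_bracket (X i) (X j)) p"
    using tangent_eqI[OF vector_field_tangent vector_field_tangent,
        OF vector_field_nab vector_field_scaleR, OF frame_field frame_field bracket_field]
    by blast
qed

lemma class_W3I:
  assumes J: "smooth_endo A J"
    and cyclic: "\<And>i j k p. Ften g nab J (X i) (X j) (X k) p + Ften g nab J (X j) (X k) (X i) p
      + Ften g nab J (X k) (X i) (X j) p = 0"
  shows "class_W3 A g nab J"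
  unfolding class_W3_def
proof (intro allI impI, elim conjE)
  fix V W Z p
  assume "vector_field A V" "vector_field A W" "vector_field A Z"
  then show "Ften g nab J V W Z p + Ften g nab J W Z V p + Ften g nab J Z V W p = 0"
    by (rule trilinear_vanishes[where p = p and T = "\<lambda>V W Z. Ften g nab J V W Z p + Ften g nab J W Z V p
        + Ften g nab J Z V W p"])
      (assumption | rule tensorial_at_add tensorial_Ften_1 tensorial_Ften_2 tensorial_Ften_3 J cyclic)+
qed

end

section \<open>The Lie group\<close>

theorem theorem3p3:
  fixes A :: "('l::{t2_space,second_countable_topology,group_add}, real^4) atlas"
    and X :: "4 \<Rightarrow> 'l vfield"
    and g :: "'l metric"
    and J1 J2 J3 :: "'l endo"
    and nab :: "'l vfield \<Rightarrow> 'l vfield \<Rightarrow> 'l vfield"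
    and l1 l2 l3 l4 :: real
  assumes lie_group: "lie_group A" "connected (UNIV :: 'l set)"
    and frame: "\<And>i. vector_field A (X i)" "\<And>i. left_invariant_field (X i)"
      "\<And>p. tangent_basis A p (\<lambda>i. X i p)"
    and brackets:
      "lie_bracket (X 1) (X 3) = l2 *\<^sub>R X 2 + l4 *\<^sub>R X 4"
      "lie_bracket (X 2) (X 4) = l1 *\<^sub>R X 1 + l3 *\<^sub>R X 3"
      "lie_bracket (X 2) (X 3) = - l2 *\<^sub>R X 1 - l3 *\<^sub>R X 4"
      "lie_bracket (X 3) (X 4) = - l4 *\<^sub>R X 1 + l3 *\<^sub>R X 2"
      "lie_bracket (X 4) (X 1) = l1 *\<^sub>R X 2 + l4 *\<^sub>R X 3"
      "lie_bracket (X 2) (X 1) = - l2 *\<^sub>R X 3 + l1 *\<^sub>R X 4"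
    and nonzero: "(l1, l2, l3, l4) \<noteq> (0, 0, 0, 0)"
    and metric: "pseudo_riemannian_metric A g" "left_invariant_metric A g"
      "\<And>p. g p (X 1 p) (X 1 p) = 1" "\<And>p. g p (X 2 p) (X 2 p) = 1"
      "\<And>p. g p (X 3 p) (X 3 p) = - 1" "\<And>p. g p (X 4 p) (X 4 p) = - 1"
      "\<And>p i j. i \<noteq> j \<Longrightarrow> g p (X i p) (X j p) = 0"
    and J1: "almost_complex_structure A J1" "left_invariant_endo A J1"
      "act J1 (X 1) = X 2" "act J1 (X 2) = - X 1"
      "act J1 (X 3) = - X 4" "act J1 (X 4) = X 3"
    and J2: "almost_complex_structure A J2" "left_invariant_endo A J2"
      "act J2 (X 1) = X 3" "act J2 (X 2) = X 4"
      "act J2 (X 3) = - X 1" "act J2 (X 4) = - X 2"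
    and J3: "J3 = (\<lambda>p. J1 p \<circ> J2 p)"
    and nabla: "levi_civita A g nab"
  shows "class_W4 A g nab J1 \<and> class_W3 A g nab J2 \<and> class_W3 A g nab J3"
proof -
  \<comment> \<open>The signature of the metric: plus on the first two frame fields, minus on the
    others.\<close>
  define \<epsilon> :: "4 \<Rightarrow> real" where "\<epsilon> i = (if i = 1 \<or> i = 2 then 1 else - 1)" for i
  interpret levi_civita_frame A X g \<epsilon> nab
  proof
    show "g p (X i p) (X j p) = (if i = j then \<epsilon> i else 0)" for p i j
      using metric(3-7) exhaust_4[of i] by (auto simp: \<epsilon>_def)
  qed (use lie_group frame metric nabla in \<open>auto simp: lie_group_def \<epsilon>_def\<close>)
  \<comment> \<open>The reversed and the diagonal brackets complete the six given ones to all
    sixteen ordered pairs.\<close>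
  note brackets' = brackets lie_bracket_self
    brackets[THEN trans[OF lie_bracket_swap arg_cong[where f = uminus]]]
  note g_simps = metric_left metric_right metric_scale_left metric_scale_right metric_zero_left
    orthonormal
  \<comment> \<open>The skewness follows from the structure constants and the signature, by
    evaluation on all frame triples.\<close>
  have "\<forall>i j k. g p (lie_bracket (X i) (X j) p) (X k p) + g p (lie_bracket (X i) (X k) p) (X j p) = 0" for p
    unfolding forall_4 by (simp del: vector_field_tangent add: brackets' g_simps \<epsilon>_def)
  then have nab_X: "nab (X i) (X j) = (1/2) *\<^sub>R lie_bracket (X i) (X j)" for i j
    by (intro nab_frame) blast
  have e1: "smooth_endo A J1" and e2: "smooth_endo A J2"
    using J1(1) J2(1) by (simp_all add: smooth_endo_almost_complex)
  then have e3: "smooth_endo A J3"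
    unfolding J3 by (rule smooth_endo_comp)
  have J3X: "act J3 (X 1) = - X 4" "act J3 (X 2) = X 3" "act J3 (X 3) = - X 2" "act J3 (X 4) = X 1"
  proof -
    have "act J3 V = act J1 (act J2 V)" for V
      by (simp add: act_def J3)
    moreover have "act J1 (- X i) = - act J1 (X i)" for i
      by (rule ext) (simp only: act_apply vfield_apply endo_scale[OF e1 frame_tangent])
    ultimately show "act J3 (X 1) = - X 4" "act J3 (X 2) = X 3" "act J3 (X 3) = - X 2"
      "act J3 (X 4) = X 1"
      by (simp_all only: J1 J2 minus_minus)
  qed
  note J1X = J1(3-6) and J2X = J2(3-6)
  note JX = J1X J2X J3X
  note JXp = JX[THEN fun_cong, unfolded act_apply vfield_apply]
  note E = endo_linear[OF e1] endo_linear[OF e2] endo_linear[OF e3]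
    endo_scale[OF e1] endo_scale[OF e2] endo_scale[OF e3]
    endo_zero[OF e1] endo_zero[OF e2] endo_zero[OF e3]
  \<comment> \<open>The structures permute the frame up to sign, so signs must be moved out of
    \<open>nab\<close>.\<close>
  have [simp]: "nab (X i) (- X j) p = - nab (X i) (X j) p" for i j p
    by (simp only: nab_minus_right frame(1) vfield_apply)
  have F: "Ften g nab J (X i) (X j) W p =
      g p (nab (X i) (act J (X j)) p) (W p) - g p (J p (nab (X i) (X j) p)) (W p)"
    if "smooth_endo A J" "vector_field A W" for J i j W p
    using Ften_eq[OF that(1) frame(1) frame(1) that(2)] by simp
  note F_simps = F[OF e1] F[OF e2] F[OF e3] nab_X brackets' JX JXp E g_simps frame(1)
  have W3: "class_W3 A g nab J2" "class_W3 A g nab J3"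
  proof -
    have "\<forall>i j k. Ften g nab J2 (X i) (X j) (X k) p + Ften g nab J2 (X j) (X k) (X i) p
      + Ften g nab J2 (X k) (X i) (X j) p = 0" for p
      unfolding forall_4 by (simp del: vector_field_tangent act_apply add: F_simps \<epsilon>_def)
    then show "class_W3 A g nab J2"
      by (intro class_W3I e2) blast
    have "\<forall>i j k. Ften g nab J3 (X i) (X j) (X k) p + Ften g nab J3 (X j) (X k) (X i) p
      + Ften g nab J3 (X k) (X i) (X j) p = 0" for p
      unfolding forall_4 by (simp del: vector_field_tangent act_apply add: F_simps \<epsilon>_def)
    then show "class_W3 A g nab J3"
      by (intro class_W3I e3) blast
  qed
  have "class_W4 A g nab J1"
    unfolding class_W4_def Let_def
  proof (intro allI impI, elim conjE)
    fix p and e :: "4 \<Rightarrow> 'l vfield" and V W Z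
    assume e: "\<forall>i. vector_field A (e i)" and basis: "tangent_basis A p (\<lambda>i. e i p)"
      and VWZ: "vector_field A V" "vector_field A W" "vector_field A Z"
    let ?\<theta> = "\<lambda>V. lee_form g nab J1 e V p"
    \<comment> \<open>The values at \<open>- X 1\<close> and \<open>- X 4\<close> are included
      because these fields are the images of \<open>X 2\<close> and \<open>X 3\<close> under
      \<open>J1\<close>.\<close>
    have \<theta>: "?\<theta> (X 1) = - l4" "?\<theta> (X 2) = l3" "?\<theta> (X 3) = - l2" "?\<theta> (X 4) = l1"
      "?\<theta> (- X 1) = l4" "?\<theta> (- X 4) = - l1"
      using e basis
      by (simp_all del: vector_field_tangent act_apply add: lee_form_frame[OF e1] sum_4 F_simps \<epsilon>_def)
    \<comment> \<open>The difference of the two sides is tensorial in each argument, so its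
      vanishing on frame triples suffices.\<close>
    let ?T = "\<lambda>V W Z. Ften g nab J1 V W Z p - 1 / 2 *
      (g p (V p) (W p) * ?\<theta> Z - g p (V p) (Z p) * ?\<theta> W
       - g p (V p) (act J1 W p) * ?\<theta> (act J1 Z) + g p (V p) (act J1 Z p) * ?\<theta> (act J1 W))"
    have T: "\<forall>i j k. ?T (X i) (X j) (X k) = 0"
      unfolding forall_4
      by (simp del: vector_field_tangent act_apply add: \<theta> F_simps \<epsilon>_def)
    have "?T V W Z = 0"
      using VWZ
      by (rule trilinear_vanishes[where p = p and T = ?T])
        (assumption | rule tensorial_at_add tensorial_at_diff tensorial_at_mult_left
          tensorial_at_mult_right tensorial_Ften_1 tensorial_Ften_2 tensorial_Ften_3
          tensorial_metric_left tensorial_metric_right tensorial_lee_form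
          tensorial_at_act[OF tensorial_metric_right e1]
          tensorial_at_act[OF tensorial_lee_form e1] vector_field_act e1
          e[rule_format] T[rule_format])+
    \<comment> \<open>In dimension 4 the quotient \<open>real CARD(4) / 4\<close> is 1, so the
      coefficient is the 1/2 used in \<open>?T\<close>.\<close>
    then show "Ften g nab J1 V W Z p = 1 / (2 * (2 * (real CARD(4) / 4) - 1)) *
        (g p (V p) (W p) * ?\<theta> Z - g p (V p) (Z p) * ?\<theta> W
         - g p (V p) (act J1 W p) * ?\<theta> (act J1 Z) + g p (V p) (act J1 Z p) * ?\<theta> (act J1 W))"
      by simp
  qed
  with W3 show ?thesis
    by blast
qed

end
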